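(* Let $n$ be an odd integer. If an edge-coloring of a complete graph contains no rainbow $n$-cycle, then it contains no rainbow $m$-cycle for every integer $m \ge 2n^2$.
   Context: A coloring is an arbitrary (not necessarily proper) assignment of colors, from an arbitrary set, to the edges of an undirected complete graph; the graph may be finite or infinite. A rainbow $n$-cycle in a coloring is a cycle through $n$ distinct vertices whose $n$ edges all receive pairwise distinct colors. *)

theory Defs
  imports Main
begin

text \<open>An edge-colouring of the complete graph on vertex type 'a (finite or infinite)
 is any function from edges, i.e. two-element sets of vertices, to colours.
 Only its values on sets {x, y} with x \<noteq> y matter.\<close>

definition rainbow_cycle :: "('a set \<Rightarrow> 'c) \<Rightarrow> nat \<Rightarrow> bool" where
  "rainbow_cycle c n \<longleftrightarrow> 3 \<le> n \<and>
     (\<exists>v :: nat \<Rightarrow> 'a. inj_on v {..<n} \<and>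
        inj_on (\<lambda>i. c {v i, v ((i + 1) mod n)}) {..<n})"

end

theory Submission
  imports Defs "HOL-Number_Theory.Cong"
begin

text \<open>
  Let \<open>n = 2 f + 1\<close>, and suppose that there is no rainbow \<open>n\<close>-cycle. In a rainbow \<open>m\<close>-cycle with
  vertices \<open>i\<close> modulo \<open>m\<close>, let the edge from \<open>i\<close> to \<open>i + 1\<close> have colour \<open>i\<close>. The chord from \<open>i\<close> to
  \<open>i + 2 f\<close> then has a colour in \<open>[i, i + 2 f)\<close>. Shortcutting along it shows that if there is no
  rainbow \<open>q\<close>-cycle, then there is no rainbow \<open>(q + n - 2)\<close>-cycle.

  The key point is that for \<open>q \<ge> 2 n + 3\<close> there is no rainbow \<open>(q + 2 n - 6)\<close>-cycle either, which is
  trivial for \<open>n = 3\<close>. Suppose that there is one; it suffices to shorten it by \<open>2 n - 6 = 4 f - 4\<close>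
  edges. If the chords at \<open>i\<close> and at \<open>i + 2 f - 1\<close> both avoid the colour \<open>i + 2 f - 1\<close>, the detour
  \<open>i, i + 2 f, i + 2 f - 1, i + 4 f - 1\<close> does so. Otherwise, going around the cycle in steps of
  \<open>2 f - 1\<close>, every chord at \<open>i\<close> has colour \<open>i\<close> or \<open>i + 2 f - 1\<close>. Let the chord at \<open>u + f\<close> have colour
  \<open>u + f\<close> (the other case is its mirror image). Closing the path
  \<open>u + 1, \<dots>, u + f, u + 3 f, u + 3 f - 1, \<dots>, u + 2 f\<close> by the edge between \<open>u + 2 f\<close> and \<open>u + 1\<close> gives
  an \<open>n\<close>-cycle, so this edge has a colour in \<open>[u + 1, u + f]\<close> or in \<open>[u + 2 f, u + 3 f)\<close>. In the first
  case it can be used in the forward direction, and in the second case on the detour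
  \<open>u, u + 2 f, u + 1, \<dots>, u + f, u + 3 f\<close>; either way \<open>2 f - 2\<close> edges are saved. Doing this on two
  disjoint stretches of the cycle saves \<open>4 f - 4\<close> edges.

  As \<open>n - 2\<close> and \<open>2 n - 6\<close> are coprime, Sylvester's bound for the coin problem shows that all large
  lengths can be reached from \<open>n\<close> in steps of these two sizes.
\<close>

subsection \<open>Rainbow paths\<close>

text \<open>
  The sets \<open>A\<close> and \<open>K\<close> are only upper bounds for the vertices and the colours. They allow paths to be
  composed without naming their vertices.
\<close>

inductive rainbow_path ::
    "('a set \<Rightarrow> 'c) \<Rightarrow> 'a set \<Rightarrow> 'c set \<Rightarrow> 'a \<Rightarrow> 'a \<Rightarrow> nat \<Rightarrow> bool" for c where
  trivial: "u \<in> A \<Longrightarrow> rainbow_path c A K u u 0"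
| extend: "\<lbrakk>rainbow_path c A K v w k; u \<notin> A; c {u, v} \<notin> K; insert u A \<subseteq> B; insert (c {u, v}) K \<subseteq> L\<rbrakk>
    \<Longrightarrow> rainbow_path c B L u w (Suc k)"

lemma rainbow_path_ends: "rainbow_path c A K u w k \<Longrightarrow> u \<in> A \<and> w \<in> A"
  by (induction rule: rainbow_path.induct) auto

lemma rainbow_path_mono:
  assumes "rainbow_path c A K u w k" "A \<subseteq> B" "K \<subseteq> L"
  shows "rainbow_path c B L u w k"
  using assms(1)
proof cases
  case trivial
  then show ?thesis using assms(2) by (auto intro: rainbow_path.trivial)
next
  case (extend A' K' v k')
  then show ?thesis using assms(2,3) rainbow_path.extend[of c A' K' v w k' u B L] by blast
qed

lemma rainbow_path_edge:
  assumes "u \<noteq> w"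
  shows "rainbow_path c {u, w} {c {u, w}} u w 1"
  using rainbow_path.extend[OF rainbow_path.trivial[of w "{w}" c "{}"]] assms by simp

lemma rainbow_path_trans:
  assumes "rainbow_path c A K u v k" "rainbow_path c A' K' v w l" "A \<inter> A' \<subseteq> {v}" "K \<inter> K' = {}"
  shows "rainbow_path c (A \<union> A') (K \<union> K') u w (k + l)"
  using assms
proof (induction rule: rainbow_path.induct)
  case (trivial u A K)
  then show ?case by (auto intro: rainbow_path_mono)
next
  case (extend A K x v k u B L)
  then have "rainbow_path c (A \<union> A') (K \<union> K') x w (k + l)" by auto
  moreover have "u \<notin> A \<union> A'"
    using extend rainbow_path_ends[OF extend.hyps(1)] by blast
  moreover have "c {u, x} \<notin> K \<union> K'" using extend by blast
  ultimately show ?case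
    using extend.hyps by (auto intro!: rainbow_path.extend)
qed

lemma rainbow_path_sym: "rainbow_path c A K u w k \<Longrightarrow> rainbow_path c A K w u k"
proof (induction rule: rainbow_path.induct)
  case (trivial u A K)
  then show ?case by (rule rainbow_path.trivial)
next
  case (extend A K v w k u B L)
  have "v \<in> A" using rainbow_path_ends[OF extend.hyps(1)] by simp
  then have "rainbow_path c {v, u} {c {v, u}} v u 1"
    using extend.hyps by (intro rainbow_path_edge) auto
  from rainbow_path_trans[OF extend.IH this]
  have "rainbow_path c (A \<union> {v, u}) (K \<union> {c {v, u}}) w u (k + 1)"
    using extend.hyps by (auto simp: insert_commute)
  then have "rainbow_path c B L w u (k + 1)"
    by (rule rainbow_path_mono) (use extend.hyps \<open>v \<in> A\<close> in \<open>auto simp: insert_commute\<close>)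
  then show ?case by simp
qed

lemma rainbow_path_imp_vertex_sequence:
  assumes "rainbow_path c A K u w k"
  shows "\<exists>p. p 0 = u \<and> p k = w \<and> inj_on p {..k} \<and> p ` {..k} \<subseteq> A \<and>
    inj_on (\<lambda>i. c {p i, p (Suc i)}) {..<k} \<and> (\<lambda>i. c {p i, p (Suc i)}) ` {..<k} \<subseteq> K"
  using assms
proof (induction rule: rainbow_path.induct)
  case (trivial u A K)
  then show ?case by (intro exI[of _ "\<lambda>_. u"]) auto
next
  case (extend A K v w k u B L)
  then obtain p where p: "p 0 = v" "p k = w" "inj_on p {..k}" "p ` {..k} \<subseteq> A"
      "inj_on (\<lambda>i. c {p i, p (Suc i)}) {..<k}" "(\<lambda>i. c {p i, p (Suc i)}) ` {..<k} \<subseteq> K"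
    by blast
  let ?p = "case_nat u p"
  have "inj_on ?p {..Suc k}"
    using p(3,4) extend.hyps by (auto simp: atMost_Suc_eq_insert_0 inj_on_def)
  moreover have "?p ` {..Suc k} \<subseteq> B"
    using p(4) extend.hyps by (auto simp: atMost_Suc_eq_insert_0 image_subset_iff)
  moreover have "inj_on (\<lambda>i. c {?p i, ?p (Suc i)}) {..<Suc k}"
    using p(1,5,6) extend.hyps by (auto simp: lessThan_Suc_eq_insert_0 inj_on_def)
  moreover have "(\<lambda>i. c {?p i, ?p (Suc i)}) ` {..<Suc k} \<subseteq> L"
    using p(1,6) extend.hyps by (auto simp: lessThan_Suc_eq_insert_0 image_subset_iff)
  ultimately show ?case using p(2) by (intro exI[of _ ?p]) simp
qed

lemma rainbow_path_close:
  assumes "rainbow_path c A K u w k" "2 \<le> k" "c {u, w} \<notin> K"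
  shows "rainbow_cycle c (Suc k)"
proof -
  obtain p where p: "p 0 = u" "p k = w" "inj_on p {..k}"
      "inj_on (\<lambda>i. c {p i, p (Suc i)}) {..<k}" "(\<lambda>i. c {p i, p (Suc i)}) ` {..<k} \<subseteq> K"
    using rainbow_path_imp_vertex_sequence[OF assms(1)] by blast
  let ?e = "\<lambda>i. c {p i, p ((i + 1) mod Suc k)}"
  have e: "?e i = c {p i, p (Suc i)}" if "i < k" for i using that by simp
  have "inj_on ?e {..<k}"
    using p(4) e by (simp add: inj_on_def)
  moreover have "?e k \<notin> ?e ` {..<k}"
    using p assms(3) e by (auto simp: insert_commute)
  ultimately have "inj_on ?e {..<Suc k}"
    by (simp add: lessThan_Suc)
  then show ?thesis
    unfolding rainbow_cycle_def using assms(2) p(3) by (auto simp: lessThan_Suc_atMost)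
qed

subsection \<open>Detours in a rainbow cycle\<close>

locale periodic_rainbow_cycle =
  fixes c :: "'a set \<Rightarrow> 'c" and m :: nat and V :: "int \<Rightarrow> 'a"
  assumes V_eq_iff: "V i = V j \<longleftrightarrow> [i = j] (mod int m)"
    and color_eq_iff: "c {V i, V (i + 1)} = c {V j, V (j + 1)} \<longleftrightarrow> [i = j] (mod int m)"
begin

definition chord_col :: "int \<Rightarrow> int \<Rightarrow> 'c" where "chord_col i j = c {V i, V j}"

definition col :: "int \<Rightarrow> 'c" where "col i = chord_col i (i + 1)"

definition path :: "int set \<Rightarrow> int set \<Rightarrow> int \<Rightarrow> int \<Rightarrow> nat \<Rightarrow> bool" where
  "path A K u w k \<longleftrightarrow> rainbow_path c (V ` A) (col ` K) (V u) (V w) k"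

definition detour :: "int \<Rightarrow> int \<Rightarrow> nat \<Rightarrow> bool" where
  "detour u w k \<longleftrightarrow> path {u..w} {u..<w} u w k"

lemma col_eq_iff: "col i = col j \<longleftrightarrow> [i = j] (mod int m)"
  by (simp add: col_def chord_col_def color_eq_iff)

lemma V_periodic: "V (i + int m * k) = V i"
  by (simp add: V_eq_iff cong_iff_dvd_diff)

lemma chord_col_periodic: "chord_col (i + int m * k) (j + int m * k) = chord_col i j"
  by (simp add: chord_col_def V_periodic)

lemma col_periodic: "col (i + int m * k) = col i"
  by (simp add: col_eq_iff cong_iff_dvd_diff)

lemma not_cong_in_window:
  assumes "i < j" "j < i + int m"
  shows "\<not> [i = j] (mod int m)"
proof -
  have "\<not> int m dvd j - i" using assms by (intro zdvd_not_zless) auto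
  then show ?thesis by (metis cong_iff_dvd_diff cong_sym)
qed

lemma inj_on_V_window: "inj_on V {a..<a + int m}"
  by (rule linorder_inj_onI) (auto simp: V_eq_iff not_cong_in_window)

lemma inj_on_col_window: "inj_on col {a..<a + int m}"
  by (rule linorder_inj_onI) (auto simp: col_eq_iff not_cong_in_window)

lemma path_mono: "\<lbrakk>path A K u w k; A \<subseteq> B; K \<subseteq> L\<rbrakk> \<Longrightarrow> path B L u w k"
  unfolding path_def by (erule rainbow_path_mono) auto

lemma path_sym: "path A K u w k \<Longrightarrow> path A K w u k"
  unfolding path_def by (rule rainbow_path_sym)

lemma path_chord:
  assumes "chord_col u w = col j" "u < w" "w < u + int m"
  shows "path {u, w} {j} u w 1"
proof -
  have "V u \<noteq> V w" using assms by (simp add: V_eq_iff not_cong_in_window)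
  from rainbow_path_edge[OF this, of c] show ?thesis
    using assms(1) by (simp add: path_def chord_col_def)
qed

lemma path_trans:
  assumes "path A K u v k" "path A' K' v w l" "A \<inter> A' \<subseteq> {v}" "K \<inter> K' = {}"
    and "A \<union> A' \<subseteq> B" "K \<union> K' \<subseteq> L" "B \<union> L \<subseteq> {a..<a + int m}"
  shows "path B L u w (k + l)"
proof -
  have "V ` A \<inter> V ` A' = V ` (A \<inter> A')"
    using assms by (intro inj_on_image_Int[OF inj_on_V_window[of a], symmetric]) auto
  moreover have "col ` K \<inter> col ` K' = col ` (K \<inter> K')"
    using assms by (intro inj_on_image_Int[OF inj_on_col_window[of a], symmetric]) auto
  ultimately have "rainbow_path c (V ` A \<union> V ` A') (col ` K \<union> col ` K') (V u) (V w) (k + l)"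
    using assms unfolding path_def by (intro rainbow_path_trans) auto
  then show ?thesis
    unfolding path_def by (rule rainbow_path_mono) (use assms in auto)
qed

lemma path_closing_chord_col:
  assumes "path A K u w k" "2 \<le> k" "\<not> rainbow_cycle c (Suc k)"
  shows "chord_col u w \<in> col ` K"
  using rainbow_path_close[OF assms(1)[unfolded path_def] assms(2)] assms(3)
  unfolding chord_col_def by blast

lemma detour_imp_le:
  assumes "detour u w k"
  shows "u \<le> w"
proof -
  have "V u \<in> V ` {u..w}"
    using rainbow_path_ends[OF assms[unfolded detour_def path_def]] ..
  then show ?thesis by auto
qed

lemma detour_trans:
  assumes "detour u v k" "detour v w l" "w < u + int m"
  shows "detour u w (k + l)"
  unfolding detour_def
proof (rule path_trans)
  show "path {u..v} {u..<v} u v k" "path {v..w} {v..<w} v w l"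
    using assms by (simp_all add: detour_def)
  show "{u..w} \<union> {u..<w} \<subseteq> {u..<u + int m}" using assms(3) by auto
qed (use assms(1,2)[THEN detour_imp_le] in auto)

lemma detour_chord:
  assumes "chord_col u w \<in> col ` {u..<w}" "w < u + int m"
  shows "detour u w 1"
proof -
  obtain j where j: "chord_col u w = col j" "j \<in> {u..<w}" using assms(1) by blast
  with assms(2) have "path {u, w} {j} u w 1" by (intro path_chord) auto
  then show ?thesis unfolding detour_def by (rule path_mono) (use j in auto)
qed

lemma detour_run:
  assumes "w = u + int k" "k < m"
  shows "detour u w k"
  using assms
proof (induction k arbitrary: w)
  case 0
  then show ?case by (simp add: detour_def path_def rainbow_path.trivial)
next
  case (Suc k)
  have "detour (u + int k) (u + int k + 1) 1"
    using Suc.prems by (intro detour_chord) (auto simp: col_def)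
  from detour_trans[OF Suc.IH[OF refl] this] show ?case using Suc.prems by (simp add: add_ac)
qed

lemma detour_imp_rainbow_cycle:
  assumes "detour u w k" "w < u + int m" "int q + (w - u) = int m + int k" "3 \<le> q"
  shows "rainbow_cycle c q"
proof (rule ccontr)
  assume "\<not> rainbow_cycle c q"
  let ?last = "u + int m - 1"
  define l where "l = nat (?last - w)"
  have l: "?last = w + int l" using assms(2) by (simp add: l_def)
  have "detour w ?last l"
    using l detour_imp_le[OF assms(1)] by (intro detour_run) linarith+
  then have "detour u ?last (k + l)" by (rule detour_trans[OF assms(1)]) simp
  moreover have "Suc (k + l) = q" using assms(3) l by linarith
  ultimately have "chord_col u ?last \<in> col ` {u..<?last}"
    using \<open>\<not> rainbow_cycle c q\<close> assms(4) unfolding detour_def by (intro path_closing_chord_col) auto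
  moreover have "chord_col u ?last = col ?last"
    using V_periodic[of u 1] by (simp add: col_def chord_col_def insert_commute)
  moreover have "inj_on col {u..?last}"
    using inj_on_col_window[of u] by (rule inj_on_subset) auto
  ultimately show False by (force dest: inj_onD)
qed

lemma chord_col_in_segment:
  assumes "\<not> rainbow_cycle c (Suc d)" "2 \<le> d" "d < m"
  shows "chord_col u (u + int d) \<in> col ` {u..<u + int d}"
  using path_closing_chord_col[OF detour_run[OF refl, unfolded detour_def]] assms by simp

lemma chord_col_at_overlap:
  assumes "\<not> rainbow_cycle c (Suc d)" "2 \<le> d" "\<not> rainbow_cycle c q" "4 \<le> q" "m + 4 = q + 2 * d"
    and v: "v = u + int d - 1"
  shows "chord_col u (u + int d) = col v \<or> chord_col v (v + int d) = col v"
proof (rule ccontr)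
  assume avoid: "\<not> ?thesis"
  have d: "2 \<le> int d" "2 * int d \<le> int m" using assms by auto
  have v_Suc: "u + int d = v + 1" using v by simp
  obtain a where a: "chord_col u (v + 1) = col a" "u \<le> a" "a < v"
    using chord_col_in_segment[of d u] assms(1-5) avoid unfolding v_Suc by (force simp: order_less_le)
  obtain b where b: "chord_col v (v + int d) = col b" "v < b" "b < v + int d"
    using chord_col_in_segment[of d v] assms(1-5) avoid by (force simp: order_less_le)
  have forward: "path {u, v + 1} {a} u (v + 1) 1"
    using a d v by (intro path_chord) auto
  have backward: "path {v, v + 1} {v} (v + 1) v 1"
    using d by (intro path_sym[OF path_chord]) (auto simp: col_def)
  have again: "path {v, v + int d} {b} v (v + int d) 1"
    using b d by (intro path_chord) auto
  have there_and_back: "path {u, v, v + 1} {a, v} u v (1 + 1)"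
    by (rule path_trans[where a = u, OF forward backward]) (use a d v in auto)
  have "detour u (v + int d) (1 + 1 + 1)"
    unfolding detour_def
    by (rule path_trans[where a = u, OF there_and_back again]) (use a b d v in auto)
  then have "rainbow_cycle c q"
    by (rule detour_imp_rainbow_cycle) (use assms in auto)
  then show False using assms(3) by simp
qed

lemma chord_col_extremal:
  assumes "\<not> rainbow_cycle c (Suc d)" "2 \<le> d" "\<not> rainbow_cycle c q" "4 \<le> q" "m + 4 = q + 2 * d"
  shows "chord_col u (u + int d) \<in> {col u, col (u + int d - 1)}"
proof (rule ccontr)
  assume other: "\<not> ?thesis"
  let ?v = "\<lambda>j. u + int j * (int d - 1)"
  have step: "?v (Suc j) = ?v j + int d - 1" for j by (simp add: algebra_simps)
  have first: "chord_col (?v (Suc j)) (?v (Suc j) + int d) = col (?v (Suc j))" for j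
  proof (induction j)
    case 0
    have "?v (Suc 0) = u + int d - 1" by simp
    then show ?case using chord_col_at_overlap[OF assms refl, of u] other by (simp only:) blast
  next
    case (Suc j)
    have "\<not> [?v (Suc j) = ?v (Suc (Suc j))] (mod int m)"
      unfolding step[of "Suc j"] by (rule not_cong_in_window) (use assms in auto)
    then show ?case
      using chord_col_at_overlap[OF assms step, of "Suc j"] Suc by (metis col_eq_iff)
  qed
  have "Suc (m - 1) = m" using assms by simp
  then have "chord_col (u + int m * (int d - 1)) (u + int d + int m * (int d - 1))
      = col (u + int m * (int d - 1))"
    using first[of "m - 1"] by (simp add: add_ac)
  then have "chord_col u (u + int d) = col u"
    by (simp only: chord_col_periodic col_periodic)
  then show False using other by simp
qed

lemma path_run_first_col_chord:
  assumes "chord_col (u + int f) (u + 3 * int f) = col (u + int f)" "1 \<le> f" "3 * f < m"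
  shows "path (insert (u + 3 * int f) {u + 1..u + int f}) {u + 1..u + int f} (u + 1) (u + 3 * int f) f"
proof -
  have run: "path {u + 1..u + int f} {u + 1..<u + int f} (u + 1) (u + int f) (f - 1)"
    unfolding detour_def[symmetric] using assms by (intro detour_run) auto
  have cross: "path {u + int f, u + 3 * int f} {u + int f} (u + int f) (u + 3 * int f) 1"
    using assms by (intro path_chord) auto
  have "path (insert (u + 3 * int f) {u + 1..u + int f}) {u + 1..u + int f}
      (u + 1) (u + 3 * int f) (f - 1 + 1)"
    by (rule path_trans[where a = "u + 1", OF run cross]) (use assms in auto)
  then show ?thesis using assms(2) by simp
qed

lemma inner_chord_col:
  assumes "\<not> rainbow_cycle c (2 * f + 1)" "1 \<le> f" "3 * f < m"
    and "chord_col (u + int f) (u + 3 * int f) = col (u + int f)"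
  shows "chord_col (u + 1) (u + 2 * int f) \<in>
    col ` ({u + 1..u + int f} \<union> {u + 2 * int f..<u + 3 * int f})" (is "_ \<in> col ` ?K")
proof -
  have backward: "path {u + 2 * int f..u + 3 * int f} {u + 2 * int f..<u + 3 * int f}
      (u + 3 * int f) (u + 2 * int f) f"
    using assms(3) by (intro path_sym[OF detour_run[unfolded detour_def]]) auto
  have "path ({u + 1..u + int f} \<union> {u + 2 * int f..u + 3 * int f}) ?K (u + 1) (u + 2 * int f) (f + f)"
    by (rule path_trans[where a = "u + 1", OF path_run_first_col_chord[OF assms(4,2,3)] backward])
      (use assms(2,3) in auto)
  from path_closing_chord_col[OF this] show ?thesis using assms(1,2) by (simp add: mult_2[of f])
qed

lemma detour_if_chord_has_first_col:
  assumes "\<not> rainbow_cycle c (2 * f + 1)" "2 \<le> f" "3 * f < m"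
    and first: "chord_col (u + int f) (u + 3 * int f) = col (u + int f)"
    and extremal: "chord_col u (u + 2 * int f) \<in> {col u, col (u + 2 * int f - 1)}"
  shows "detour u (u + 3 * int f) (f + 2)"
proof -
  have f: "2 \<le> int f" "3 * int f < int m" "1 \<le> f" using assms by auto
  obtain g where g: "chord_col (u + 1) (u + 2 * int f) = col g"
      and "g \<in> {u + 1..u + int f} \<or> g \<in> {u + 2 * int f..<u + 3 * int f}"
    using inner_chord_col[OF assms(1) f(3) assms(3) first] by blast
  then consider "g \<in> {u + 1..u + int f}" | "g \<in> {u + 2 * int f..<u + 3 * int f}" by blast
  then show ?thesis
  proof cases
    case 1
    have "detour u (u + 1) 1" "detour (u + 2 * int f) (u + 3 * int f) f"
      using assms by (auto intro: detour_run)
    moreover have "detour (u + 1) (u + 2 * int f) 1"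
      using g 1 f by (intro detour_chord) auto
    ultimately have "detour u (u + 3 * int f) (1 + (1 + f))"
      using f by (intro detour_trans[where v = "u + 1"] detour_trans[where v = "u + 2 * int f"]) auto
    then show ?thesis by simp
  next
    case 2
    obtain e where e: "chord_col u (u + 2 * int f) = col e" "e \<in> {u, u + 2 * int f - 1}"
      using extremal by blast
    have out: "path {u, u + 2 * int f} {e} u (u + 2 * int f) 1"
      using e(1) f by (intro path_chord) auto
    have backward: "path {u + 1, u + 2 * int f} {g} (u + 2 * int f) (u + 1) 1"
      using g f by (intro path_sym[OF path_chord]) auto
    have "path {u, u + 1, u + 2 * int f} {e, g} u (u + 1) (1 + 1)"
      by (rule path_trans[where a = u, OF out backward]) (use e(2) 2 f in auto)
    then have "detour u (u + 3 * int f) (1 + 1 + f)"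
      unfolding detour_def
      by (rule path_trans[where a = u, OF _ path_run_first_col_chord[OF first f(3) assms(3)]])
        (use e(2) 2 f in auto)
    then show ?thesis by simp
  qed
qed

lemma reflect: "periodic_rainbow_cycle c m (\<lambda>i. V (- i))"
proof
  fix i j
  show "V (- i) = V (- j) \<longleftrightarrow> [i = j] (mod int m)"
    by (simp add: V_eq_iff cong_minus_minus_iff)
  have "c {V (- i), V (- (i + 1))} = col (- i - 1)" for i
    by (simp add: col_def chord_col_def insert_commute)
  moreover have "[- i - 1 = - j - 1] (mod int m) \<longleftrightarrow> [i = j] (mod int m)"
    by (metis add_uminus_conv_diff cong_add_rcancel cong_minus_minus_iff)
  ultimately show "c {V (- i), V (- (i + 1))} = c {V (- j), V (- (j + 1))} \<longleftrightarrow> [i = j] (mod int m)"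
    by (simp add: col_eq_iff)
qed

lemma detour_if_chord_has_last_col:
  assumes "\<not> rainbow_cycle c (2 * f + 1)" "2 \<le> f" "3 * f < m"
    and last: "chord_col u (u + 2 * int f) = col (u + 2 * int f - 1)"
    and extremal: "chord_col (u + int f) (u + 3 * int f) \<in> {col (u + int f), col (u + 3 * int f - 1)}"
  shows "detour u (u + 3 * int f) (f + 2)"
proof -
  interpret R: periodic_rainbow_cycle c m "\<lambda>i. V (- i)" by (rule reflect)
  have R_chord_col: "R.chord_col i j = chord_col (- j) (- i)" for i j
    by (simp add: R.chord_col_def chord_col_def insert_commute)
  have R_col: "R.col i = col (- i - 1)" for i
    by (simp add: R.col_def col_def R_chord_col)
  let ?w = "- u - 3 * int f"
  have "R.detour ?w (?w + 3 * int f) (f + 2)"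
    by (rule R.detour_if_chord_has_first_col)
      (use assms in \<open>auto simp: R_chord_col R_col algebra_simps\<close>)
  moreover have "(\<lambda>i. V (- i)) ` {?w..- u} = V ` {u..u + 3 * int f}"
    unfolding image_image[of V uminus, symmetric] image_uminus_atLeastAtMost
    by (simp add: add.commute)
  moreover have "R.col ` {?w..<- u} \<subseteq> col ` {u..<u + 3 * int f}"
    by (auto simp: R_col)
  ultimately have "path {u..u + 3 * int f} {u..<u + 3 * int f} (u + 3 * int f) u (f + 2)"
    unfolding R.detour_def R.path_def path_def
    by (auto elim!: rainbow_path_mono simp: add.commute)
  then show ?thesis unfolding detour_def by (rule path_sym)
qed

lemma detour_if_chord_cols_extremal:
  assumes omit: "\<not> rainbow_cycle c (2 * f + 1)" and f: "2 \<le> f" "4 * f < m"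
    and extremal: "\<And>i. chord_col i (i + 2 * int f) \<in> {col i, col (i + 2 * int f - 1)}"
  shows "detour u (u + 4 * int f) (2 * f + 2)"
proof -
  have run: "detour w (w + int f) f" for w
    using f by (intro detour_run) simp_all
  have shift: "u + int f + 2 * int f = u + 3 * int f" by simp
  consider "chord_col (u + int f) (u + 3 * int f) = col (u + int f)"
    | "chord_col (u + int f) (u + 3 * int f) = col (u + 3 * int f - 1)"
    using extremal[of "u + int f"] unfolding shift by blast
  then show ?thesis
  proof cases
    case 1
    have "detour u (u + 3 * int f) (f + 2)"
      using detour_if_chord_has_first_col[OF omit _ _ 1] extremal f by simp
    then have "detour u (u + 3 * int f + int f) (f + 2 + f)"
      by (rule detour_trans[OF _ run]) (use f in simp)
    then show ?thesis by (simp add: mult_2 add.commute)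
  next
    case 2
    have "detour (u + int f) (u + int f + 3 * int f) (f + 2)"
      using detour_if_chord_has_last_col[OF omit, of "u + int f"] 2 extremal[of "u + 2 * int f"] f
      by (simp add: algebra_simps)
    then have "detour u (u + int f + 3 * int f) (f + (f + 2))"
      by (rule detour_trans[OF run]) (use f in simp)
    then show ?thesis by (simp add: mult_2 add.commute)
  qed
qed

end

lemma rainbow_cycle_imp_periodic:
  assumes "rainbow_cycle c m"
  obtains V where "periodic_rainbow_cycle c m V"
proof -
  obtain v where m: "3 \<le> m" and v: "inj_on v {..<m}"
      "inj_on (\<lambda>i. c {v i, v ((i + 1) mod m)}) {..<m}"
    using assms unfolding rainbow_cycle_def by blast
  define r where "r i = nat (i mod int m)" for i
  have r: "r i < m" for i using m by (simp add: r_def nat_less_iff)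
  have r_eq: "r i = r j \<longleftrightarrow> [i = j] (mod int m)" for i j
    using m by (simp add: r_def eq_nat_nat_iff cong_def)
  have r_Suc: "r (i + 1) = (r i + 1) mod m" for i
  proof -
    have "int (r (i + 1)) = int ((r i + 1) mod m)"
      using m by (simp add: r_def zmod_int mod_simps add.commute)
    then show ?thesis by linarith
  qed
  have "periodic_rainbow_cycle c m (v \<circ> r)"
  proof
    fix i j
    show "(v \<circ> r) i = (v \<circ> r) j \<longleftrightarrow> [i = j] (mod int m)"
      using inj_on_eq_iff[OF v(1), of "r i" "r j"] r r_eq by simp
    show "c {(v \<circ> r) i, (v \<circ> r) (i + 1)} = c {(v \<circ> r) j, (v \<circ> r) (j + 1)} \<longleftrightarrow> [i = j] (mod int m)"
      using inj_on_eq_iff[OF v(2), of "r i" "r j"] r r_eq r_Suc by simp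
  qed
  then show ?thesis by (rule that)
qed

subsection \<open>Lengths without rainbow cycles\<close>

lemma no_rainbow_cycle_add:
  assumes "\<not> rainbow_cycle c n" "3 \<le> n" "\<not> rainbow_cycle c q" "3 \<le> q"
  shows "\<not> rainbow_cycle c (q + (n - 2))"
proof
  assume "rainbow_cycle c (q + (n - 2))"
  then obtain V where "periodic_rainbow_cycle c (q + (n - 2)) V" by (rule rainbow_cycle_imp_periodic)
  then interpret periodic_rainbow_cycle c "q + (n - 2)" V .
  have "chord_col 0 (0 + int (n - 1)) \<in> col ` {0..<0 + int (n - 1)}"
    using assms by (intro chord_col_in_segment) auto
  then have "detour 0 (0 + int (n - 1)) 1"
    by (rule detour_chord) (use assms in auto)
  then have "rainbow_cycle c q"
    by (rule detour_imp_rainbow_cycle) (use assms in auto)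
  then show False using assms(3) by simp
qed

lemma no_rainbow_cycle_add_if_odd:
  assumes n: "odd n" "3 \<le> n" "\<not> rainbow_cycle c n" and q: "2 * n + 3 \<le> q" "\<not> rainbow_cycle c q"
  shows "\<not> rainbow_cycle c (q + 2 * (n - 3))"
proof (cases "n = 3")
  case True
  then show ?thesis using q(2) by simp
next
  case False
  then obtain f where f: "n = 2 * f + 1" "2 \<le> f" using n(1,2) by (auto elim!: oddE)
  define m where "m = q + 2 * (n - 3)"
  have m: "m + 4 = q + 2 * (2 * f)" "8 * f < m" using q f by (auto simp: m_def)
  have "\<not> rainbow_cycle c m"
  proof
    assume "rainbow_cycle c m"
    then obtain V where "periodic_rainbow_cycle c m V" by (rule rainbow_cycle_imp_periodic)
    then interpret periodic_rainbow_cycle c m V .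
    have "chord_col i (i + 2 * int f) \<in> {col i, col (i + 2 * int f - 1)}" for i
      using chord_col_extremal[of "2 * f" q i] n q f m by simp
    then have shortcut: "detour u (u + 4 * int f) (2 * f + 2)" for u
      using n f m by (intro detour_if_chord_cols_extremal) auto
    have "detour 0 (0 + 4 * int f + 4 * int f) (2 * f + 2 + (2 * f + 2))"
      by (rule detour_trans[OF shortcut shortcut]) (use m in auto)
    then have "rainbow_cycle c q"
      by (rule detour_imp_rainbow_cycle) (use q m in auto)
    then show False using q(2) by simp
  qed
  then show ?thesis by (simp add: m_def)
qed

lemma no_rainbow_cycle_add_mult:
  assumes "\<not> rainbow_cycle c n" "3 \<le> n" "\<not> rainbow_cycle c q" "3 \<le> q"
  shows "\<not> rainbow_cycle c (q + j * (n - 2))"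
proof (induction j)
  case 0
  show ?case using assms(3) by simp
next
  case (Suc j)
  show ?case using no_rainbow_cycle_add[OF assms(1,2) Suc] assms(4) by (simp add: ac_simps)
qed

lemma no_rainbow_cycle_add_mult_if_odd:
  assumes "odd n" "3 \<le> n" "\<not> rainbow_cycle c n" "2 * n + 3 \<le> q" "\<not> rainbow_cycle c q"
  shows "\<not> rainbow_cycle c (q + t * (2 * (n - 3)))"
proof (induction t)
  case 0
  show ?case using assms(5) by simp
next
  case (Suc t)
  show ?case using no_rainbow_cycle_add_if_odd[OF assms(1-3) _ Suc] assms(4) by (simp add: ac_simps)
qed

lemma coprime_nat_combination_exists:
  fixes a b M :: nat
  assumes "coprime a b" and "(a - 1) * (b - 1) \<le> M"
  obtains j t where "M = j * a + t * b"
proof (cases "a = 0 \<or> b = 0")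
  case True
  then have "M = M * a + 0 * b \<or> M = 0 * a + M * b" using assms(1) by auto
  then show ?thesis using that by blast
next
  case False
  obtain y where y: "[b * y = 1] (mod a)"
    using assms(1) cong_solve_coprime_nat[of b a] by (auto simp: coprime_commute)
  define t where "t = y * M mod a"
  have "[t * b = b * y * M] (mod a)" by (simp add: t_def cong_def mod_simps ac_simps)
  also have "[b * y * M = M] (mod a)" using cong_mult[OF y cong_refl] by simp
  finally have "int a dvd int M - int (t * b)"
    by (metis cong_int_iff cong_iff_dvd_diff cong_sym)
  then obtain j where j: "int M - int (t * b) = int a * j" by blast
  have "int (t * b) \<le> (int a - 1) * int b"
  proof -
    have "t \<le> a - 1" using False by (simp add: t_def less_Suc_eq_le[symmetric])
    then have "int (t * b) \<le> int ((a - 1) * b)" by (intro of_nat_mono mult_right_mono) auto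
    then show ?thesis using False by simp
  qed
  moreover have "(int a - 1) * (int b - 1) \<le> int M"
  proof -
    have "(int a - 1) * (int b - 1) = int ((a - 1) * (b - 1))"
      using False by (simp add: Suc_leI)
    then show ?thesis using assms(2) by linarith
  qed
  ultimately have "int a * (- 1) < int a * j"
    unfolding j[symmetric] using False by (simp add: algebra_simps)
  then have "- 1 < j" using False mult_less_cancel_left_pos[of "int a" "- 1" j] by simp
  then have "int M = int (nat j * a + t * b)" using j by (simp add: algebra_simps)
  then show ?thesis using that of_nat_eq_iff by blast
qed

lemma large_length_decomposition:
  fixes n m :: nat
  assumes "odd n" "3 \<le> n" "2 * n ^ 2 \<le> m"
  obtains j t where "m = n + j * (n - 2) + t * (2 * (n - 3))" and "2 * n + 3 \<le> n + j * (n - 2)"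
proof -
  obtain k where k: "n = k + 3" using assms(2) nat_le_iff_add add.commute by metis
  have "k * (2 * k - 1) \<le> 2 * k ^ 2" by (simp add: power2_eq_square right_diff_distrib')
  \<comment> \<open>Even for \<open>n = 3\<close>, the start \<open>n + 6 * (n - 2)\<close> is at least \<open>2 * n + 3\<close>.\<close>
  then have large: "(n - 2 - 1) * (2 * (n - 3) - 1) + (n + 6 * (n - 2)) \<le> m"
    using assms(3) by (simp add: k power2_eq_square algebra_simps)
  have "coprime (n - 2) (2 * (n - 3))"
    using assms(1) k by simp
  then obtain j t where "m - (n + 6 * (n - 2)) = j * (n - 2) + t * (2 * (n - 3))"
    using add_le_imp_le_diff[OF large] by (rule coprime_nat_combination_exists)
  then have "m = n + 6 * (n - 2) + (j * (n - 2) + t * (2 * (n - 3)))" using large by linarith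
  also have "\<dots> = n + (j + 6) * (n - 2) + t * (2 * (n - 3))" by (simp add: add_mult_distrib)
  finally show ?thesis
  proof (rule that)
    have "2 * n + 3 \<le> n + 6 * (n - 2)" using assms(2) by simp
    also have "\<dots> \<le> n + (j + 6) * (n - 2)" by simp
    finally show "2 * n + 3 \<le> n + (j + 6) * (n - 2)" .
  qed
qed

theorem theorem5:
  fixes c :: "'a set \<Rightarrow> 'c" and n m :: nat
  assumes "odd n" and "3 \<le> n"
    and "\<not> rainbow_cycle c n"
    and "m \<ge> 2 * n ^ 2"
  shows "\<not> rainbow_cycle c m"
proof -
  obtain j t where m: "m = n + j * (n - 2) + t * (2 * (n - 3))" and "2 * n + 3 \<le> n + j * (n - 2)"
    using assms(1,2,4) by (rule large_length_decomposition)
  moreover have "\<not> rainbow_cycle c (n + j * (n - 2))"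
    using assms(2,3) by (intro no_rainbow_cycle_add_mult)
  ultimately show ?thesis
    unfolding m using assms(1-3) by (intro no_rainbow_cycle_add_mult_if_odd)
qed

end
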